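(* Let $R=\mathcal{R}(d_R(t),h_R(t))$ and $S=\mathcal{R}(d_S(t),h_S(t))$ be two Riordan arrays. Then the matrix sum $R+S$ is a Riordan array if and only if $h_R(t)=h_S(t)$ and $d_R(0)+d_S(0)\neq 0$. In that case, writing $h(t)$ for the common series, $R+S=\mathcal{R}(d_R(t)+d_S(t),h(t))$.
   Context: All power series are formal power series (over a field of characteristic $0$, e.g. $\mathbb{Q}$ or $\mathbb{C}$). For formal power series $d(t),h(t)$ with $d(0)\neq 0$, $h(0)=0$, $h'(0)\neq 0$, the Riordan array $\mathcal{R}(d(t),h(t))$ is the infinite lower triangular matrix (rows and columns indexed by $n,k\ge 0$) whose $(n,k)$-entry is $[t^n]\,d(t)h(t)^k$, the coefficient of $t^n$ in $d(t)h(t)^k$. A matrix "is a Riordan array" if it equals $\mathcal{R}(d(t),h(t))$ for some such pair. *)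

theory Defs
  imports "HOL-Computational_Algebra.Formal_Power_Series"
begin

definition riordan_pair :: "'a::field_char_0 fps \<Rightarrow> 'a fps \<Rightarrow> bool" where
  "riordan_pair d h \<longleftrightarrow>
     fps_nth d 0 \<noteq> 0 \<and> fps_nth h 0 = 0 \<and> fps_nth (fps_deriv h) 0 \<noteq> 0"

text \<open>Infinite matrices are functions of the row index \<open>n\<close> and the column index \<open>k\<close>,
  both starting at 0.\<close>

definition riordan :: "'a::field_char_0 fps \<Rightarrow> 'a fps \<Rightarrow> nat \<Rightarrow> nat \<Rightarrow> 'a" where
  "riordan d h n k = fps_nth (d * h ^ k) n"

definition is_riordan_array :: "(nat \<Rightarrow> nat \<Rightarrow> 'a::field_char_0) \<Rightarrow> bool" where
  "is_riordan_array M \<longleftrightarrow> (\<exists>d h. riordan_pair d h \<and> M = riordan d h)"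

definition matrix_sum ::
    "(nat \<Rightarrow> nat \<Rightarrow> 'a::field_char_0) \<Rightarrow> (nat \<Rightarrow> nat \<Rightarrow> 'a) \<Rightarrow> nat \<Rightarrow> nat \<Rightarrow> 'a" where
  "matrix_sum A B n k = A n k + B n k"

end

theory Submission imports Defs begin

text \<open>Columns 0, 1 and 2 of a sum \<open>R + S = \<R>(d, h)\<close> give
  \<open>d h\<^sup>k = d\<^sub>R h\<^sub>R\<^sup>k + d\<^sub>S h\<^sub>S\<^sup>k\<close> for \<open>k \<le> 2\<close>. Eliminating \<open>d\<close> and \<open>h\<close> through
  \<open>d \<cdot> (d h\<^sup>2) = (d h)\<^sup>2\<close> leaves \<open>d\<^sub>R d\<^sub>S (h\<^sub>R - h\<^sub>S)\<^sup>2 = 0\<close>, and power series over a field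
  form an integral domain.\<close>

lemma matrix_sum_riordan_same:
  "matrix_sum (riordan d h) (riordan e h) = riordan (d + e) h"
  by (simp add: fun_eq_iff matrix_sum_def riordan_def distrib_right)

text \<open>Column \<open>k\<close> of a Riordan array has generating function
  \<open>d * h ^ k\<close>, so a matrix equation splits into one power series identity per
  column.\<close>

lemma matrix_sum_riordan_eqD:
  assumes "matrix_sum (riordan d\<^sub>1 h\<^sub>1) (riordan d\<^sub>2 h\<^sub>2) = riordan d h"
  shows "d * h ^ k = d\<^sub>1 * h\<^sub>1 ^ k + d\<^sub>2 * h\<^sub>2 ^ k"
proof (rule fps_ext)
  fix n
  show "fps_nth (d * h ^ k) n = fps_nth (d\<^sub>1 * h\<^sub>1 ^ k + d\<^sub>2 * h\<^sub>2 ^ k) n"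
    using fun_cong[OF fun_cong[OF assms, of n], of k]
    by (simp add: matrix_sum_def riordan_def)
qed

text \<open>A variance argument: weights \<open>a\<close>, \<open>b\<close> at \<open>x\<close>,
  \<open>y\<close> have the total mass and first two moments of mass \<open>c\<close> at
  \<open>z\<close>, so their variance vanishes. Avoiding division also covers
  \<open>c = 0\<close>.\<close>

lemma weighted_powers_sum_eq_imp_eq:
  fixes a b c x y z :: "'a::idom"
  assumes "c = a + b" "c * z = a * x + b * y" "c * z\<^sup>2 = a * x\<^sup>2 + b * y\<^sup>2"
    and "a \<noteq> 0" "b \<noteq> 0"
  shows "x = y"
proof -
  have "(a + b) * (a * x\<^sup>2 + b * y\<^sup>2) = c * (c * z\<^sup>2)"
    using assms(1,3) by simp
  also have "\<dots> = (c * z)\<^sup>2"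
    by (simp add: power2_eq_square algebra_simps)
  also have "\<dots> = (a * x + b * y)\<^sup>2"
    using assms(2) by simp
  \<comment> \<open>Lagrange's identity: the two ends of the chain differ by exactly this
    product.\<close>
  finally have "a * b * (x - y)\<^sup>2 = 0"
    by (simp add: power2_eq_square algebra_simps)
  with assms(4,5) show ?thesis by simp
qed

lemma is_riordan_array_matrix_sum_iff:
  assumes R: "riordan_pair d\<^sub>R h\<^sub>R" and S: "riordan_pair d\<^sub>S h\<^sub>S"
  shows "is_riordan_array (matrix_sum (riordan d\<^sub>R h\<^sub>R) (riordan d\<^sub>S h\<^sub>S)) \<longleftrightarrow>
    h\<^sub>R = h\<^sub>S \<and> fps_nth d\<^sub>R 0 + fps_nth d\<^sub>S 0 \<noteq> 0"
proof
  assume "is_riordan_array (matrix_sum (riordan d\<^sub>R h\<^sub>R) (riordan d\<^sub>S h\<^sub>S))"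
  then obtain d h where dh: "riordan_pair d h"
    and eq: "matrix_sum (riordan d\<^sub>R h\<^sub>R) (riordan d\<^sub>S h\<^sub>S) = riordan d h"
    unfolding is_riordan_array_def by blast
  note col = matrix_sum_riordan_eqD[OF eq]
  have d: "d = d\<^sub>R + d\<^sub>S" using col[of 0] by simp
  \<comment> \<open>Nonzero constant terms make both weights nonzero series, as cancellation
    requires.\<close>
  have "d\<^sub>R \<noteq> 0" "d\<^sub>S \<noteq> 0" using R S by (auto simp: riordan_pair_def)
  then have "h\<^sub>R = h\<^sub>S"
    using weighted_powers_sum_eq_imp_eq[OF d _ col[of 2]] col[of 1] by simp
  moreover have "fps_nth d\<^sub>R 0 + fps_nth d\<^sub>S 0 \<noteq> 0"
    using dh d by (simp add: riordan_pair_def)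
  ultimately show "h\<^sub>R = h\<^sub>S \<and> fps_nth d\<^sub>R 0 + fps_nth d\<^sub>S 0 \<noteq> 0" ..
next
  assume "h\<^sub>R = h\<^sub>S \<and> fps_nth d\<^sub>R 0 + fps_nth d\<^sub>S 0 \<noteq> 0"
  \<comment> \<open>The conditions on \<open>h\<^sub>S\<close> come from \<open>S\<close>; only the
    constant terms of the first components could cancel.\<close>
  with S have "riordan_pair (d\<^sub>R + d\<^sub>S) h\<^sub>S" "h\<^sub>R = h\<^sub>S"
    by (simp_all add: riordan_pair_def)
  then show "is_riordan_array (matrix_sum (riordan d\<^sub>R h\<^sub>R) (riordan d\<^sub>S h\<^sub>S))"
    unfolding is_riordan_array_def using matrix_sum_riordan_same by blast
qed

theorem theorem3p1:
  fixes d\<^sub>R h\<^sub>R d\<^sub>S h\<^sub>S :: "'a::field_char_0 fps"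
    and R S :: "nat \<Rightarrow> nat \<Rightarrow> 'a"
  assumes "riordan_pair d\<^sub>R h\<^sub>R" and "R = riordan d\<^sub>R h\<^sub>R"
    and "riordan_pair d\<^sub>S h\<^sub>S" and "S = riordan d\<^sub>S h\<^sub>S"
  shows "(is_riordan_array (matrix_sum R S) \<longleftrightarrow>
            h\<^sub>R = h\<^sub>S \<and> fps_nth d\<^sub>R 0 + fps_nth d\<^sub>S 0 \<noteq> 0) \<and>
         (\<forall>h. is_riordan_array (matrix_sum R S) \<and> h = h\<^sub>R \<and> h = h\<^sub>S \<longrightarrow>
            riordan_pair (d\<^sub>R + d\<^sub>S) h \<and> matrix_sum R S = riordan (d\<^sub>R + d\<^sub>S) h)"
proof -
  have iff: "is_riordan_array (matrix_sum R S) \<longleftrightarrow>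
      h\<^sub>R = h\<^sub>S \<and> fps_nth d\<^sub>R 0 + fps_nth d\<^sub>S 0 \<noteq> 0"
    using is_riordan_array_matrix_sum_iff[OF assms(1,3)] assms(2,4) by simp
  \<comment> \<open>Here \<open>iff\<close> supplies the nonzero constant term of
    \<open>d\<^sub>R + d\<^sub>S\<close>.\<close>
  moreover have "riordan_pair (d\<^sub>R + d\<^sub>S) h \<and> matrix_sum R S = riordan (d\<^sub>R + d\<^sub>S) h"
    if "is_riordan_array (matrix_sum R S)" "h = h\<^sub>R" "h = h\<^sub>S" for h
    using that iff assms by (simp add: riordan_pair_def matrix_sum_riordan_same)
  ultimately show ?thesis by blast
qed

end
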